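(* For each integer $n\ge2$, let $h=1/(n-1)$ and let $\rho_h$ be the set of uniformly spaced knots $r_j=1+(j-1)h$, $j\in\{1,\ldots,n\}$, so that $[r_1,r_n]=[1,2]$. Then, for any $\varepsilon>0$ arbitrarily small, there exist $f_\varepsilon\in\Lambda_0$ and a constant $M>0$ such that $$M\,h^{3/2+\varepsilon}\le\|f_\varepsilon-\sigma_h\|_{L^\infty[1,2]}$$ holds for all sufficiently small $h>0$ (of the form $h=1/(n-1)$) and all $\sigma_h\in\mathcal{S}_0(\rho_h)$.
   Context: $\Lambda_0$ is the space of complex-valued $f\in C^1(0,\infty)$ such that $f'$ is absolutely continuous on every compact interval $[a,b]$ with $0<a<b<\infty$ and $$\int_0^\infty\left(r|f''(r)|^2+\frac1r|f'(r)|^2\right)dr<\infty.$$ Define the differential operators $$L_0=r\frac{d^4}{dr^4}+2\frac{d^3}{dr^3}-\frac1r\frac{d^2}{dr^2}+\frac1{r^2}\frac{d}{dr},\quad G_0=\frac{d^3}{dr^3}-\frac1r\frac{d^2}{dr^2}+\frac1{r^2}\frac{d}{dr},\quad R_0=\frac1r\left[\frac{d^2}{dr^2}+\frac1r\frac{d}{dr}\right].$$ On any open subinterval of $(0,\infty)$ their null spaces are $\mathrm{Ker}\,L_0=\mathrm{span}\{r^2,r^2\ln r,1,\ln r\}$, $\mathrm{Ker}\,G_0=\mathrm{span}\{r^2,r^2\ln r,1\}$, $\mathrm{Ker}\,R_0=\mathrm{span}\{1,\ln r\}$. For knots $\rho=\{r_1<\cdots<r_n\}\subset(0,\infty)$,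 a function $\eta:[0,\infty)\to\mathbb{C}$, continuous at $0$, is called a Beppo Levi $L_0$-spline on $\rho$ if: (i) $L_0\eta(r)=0$ for all $r\in(r_j,r_{j+1})$ and all $j\in\{1,\ldots,n-1\}$; (ii) $G_0\eta(r)=0$ for all $r\in(0,r_1)$ and $R_0\eta(r)=0$ for all $r>r_n$; (iii) $\eta$ is $C^2$-continuous at each knot $r_1,\ldots,r_n$. The set of all such functions is $\mathcal{S}_0(\rho)$. *)

theory Defs
  imports "HOL-Probability.Essential_Supremum"
begin

text \<open>Functions on \<open>(0,\<infinity>)\<close> or \<open>[0,\<infinity>)\<close> are total functions \<open>real \<Rightarrow> complex\<close>; every condition
  below depends only on their values on the intended domain.\<close>

definition dr :: "nat \<Rightarrow> (real \<Rightarrow> complex) \<Rightarrow> real \<Rightarrow> complex" where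
  "dr k f = ((\<lambda>g r. vector_derivative g (at r)) ^^ k) f"

text \<open>The derivative \<^term>\<open>dr k f\<close> carries no information where \<open>f\<close> fails to be \<open>k\<close> times
  differentiable, so existence is always required separately. Meant for open \<open>S\<close>.\<close>

definition times_differentiable_on :: "nat \<Rightarrow> (real \<Rightarrow> complex) \<Rightarrow> real set \<Rightarrow> bool" where
  "times_differentiable_on k f S \<longleftrightarrow> (\<forall>i<k. \<forall>r\<in>S. dr i f differentiable (at r))"

definition abs_continuous_on_interval :: "real \<Rightarrow> real \<Rightarrow> (real \<Rightarrow> complex) \<Rightarrow> bool" where
  "abs_continuous_on_interval a b g \<longleftrightarrow>
    (\<forall>e>0. \<exists>d>0. \<forall>(N::nat) u v.
       (\<forall>i<N. a \<le> u i \<and> u i \<le> v i \<and> v i \<le> b) \<longrightarrow>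
       disjoint_family_on (\<lambda>i. {u i<..<v i}) {..<N} \<longrightarrow>
       (\<Sum>i<N. v i - u i) < d \<longrightarrow>
       (\<Sum>i<N. norm (g (v i) - g (u i))) < e)"

text \<open>In \<open>Lambda0\<close> the second derivative exists only almost everywhere; the values of
  \<^term>\<open>dr 2 f\<close> on the exceptional null set do not affect Lebesgue integrability.\<close>

definition Lambda0 :: "(real \<Rightarrow> complex) set" where
  "Lambda0 = {f.
     times_differentiable_on 1 f {0<..} \<and> continuous_on {0<..} (dr 1 f) \<and>
     (\<forall>a b. 0 < a \<longrightarrow> a < b \<longrightarrow> abs_continuous_on_interval a b (dr 1 f)) \<and>
     set_integrable lebesgue {0<..}
       (\<lambda>r. r * (cmod (dr 2 f r))\<^sup>2 + 1 / r * (cmod (dr 1 f r))\<^sup>2)}"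

definition L0 :: "(real \<Rightarrow> complex) \<Rightarrow> real \<Rightarrow> complex" where
  "L0 f r = r *\<^sub>R dr 4 f r + 2 *\<^sub>R dr 3 f r - (1 / r) *\<^sub>R dr 2 f r + (1 / r\<^sup>2) *\<^sub>R dr 1 f r"

definition G0 :: "(real \<Rightarrow> complex) \<Rightarrow> real \<Rightarrow> complex" where
  "G0 f r = dr 3 f r - (1 / r) *\<^sub>R dr 2 f r + (1 / r\<^sup>2) *\<^sub>R dr 1 f r"

definition R0 :: "(real \<Rightarrow> complex) \<Rightarrow> real \<Rightarrow> complex" where
  "R0 f r = (1 / r) *\<^sub>R (dr 2 f r + (1 / r) *\<^sub>R dr 1 f r)"

definition C2_at :: "(real \<Rightarrow> complex) \<Rightarrow> real \<Rightarrow> bool" where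
  "C2_at f x \<longleftrightarrow>
    (\<exists>U. open U \<and> x \<in> U \<and> times_differentiable_on 2 f U \<and> continuous_on U (dr 2 f))"

text \<open>Beppo Levi \<open>L\<^sub>0\<close>-splines on the knots \<open>\<rho> 1 < \<dots> < \<rho> n\<close> in \<open>(0,\<infinity>)\<close>; only the values of \<open>\<rho>\<close>
  on \<open>{1..n}\<close> matter.\<close>

definition S0 :: "nat \<Rightarrow> (nat \<Rightarrow> real) \<Rightarrow> (real \<Rightarrow> complex) set" where
  "S0 n \<rho> = {\<eta>.
     continuous (at 0 within {0..}) \<eta> \<and>
     (\<forall>j\<in>{1..n - 1}.
        times_differentiable_on 4 \<eta> {\<rho> j<..<\<rho> (Suc j)} \<and>
        (\<forall>r\<in>{\<rho> j<..<\<rho> (Suc j)}. L0 \<eta> r = 0)) \<and>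
     times_differentiable_on 3 \<eta> {0<..<\<rho> 1} \<and> (\<forall>r\<in>{0<..<\<rho> 1}. G0 \<eta> r = 0) \<and>
     times_differentiable_on 2 \<eta> {\<rho> n<..} \<and> (\<forall>r\<in>{\<rho> n<..}. R0 \<eta> r = 0) \<and>
     (\<forall>j\<in>{1..n}. C2_at \<eta> (\<rho> j))}"

definition uniform_knots :: "real \<Rightarrow> nat \<Rightarrow> real" where
  "uniform_knots h j = 1 + (real j - 1) * h"

definition Linf_norm :: "real \<Rightarrow> real \<Rightarrow> (real \<Rightarrow> complex) \<Rightarrow> ereal" where
  "Linf_norm a b g = esssup (lebesgue_on {a..b}) (\<lambda>r. ereal (cmod (g r)))"

end

theory Submission
  imports Defs
begin

text \<open>The function \<open>f(r) = (max 0 (ln r))\<^sup>a\<close> with \<open>a\<close> slightly above \<open>3/2\<close> has a singularity at \<open>r = 1\<close>, which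
is the first knot for every \<open>h\<close>. On the first subinterval \<open>(1, 1 + h)\<close> a spline is an element of the
four-dimensional kernel of \<open>L\<^sub>0\<close>, and such a function cannot follow \<open>f\<close> at scale \<open>h\<close> better than the size
\<open>h\<^sup>a\<close> of \<open>f\<close> there.

To make this quantitative, put \<open>s = ln r\<close>. The kernel of \<open>L\<^sub>0\<close> is then spanned by \<open>1, s, e\<^bsup>2s\<^esup>, s e\<^bsup>2s\<^esup>\<close>, so it is
annihilated by the difference operator with characteristic polynomial \<open>(x - 1)\<^sup>2 (x - Q)\<^sup>2\<close>, \<open>Q = e\<^bsup>2t\<^esup>\<close>,
on the five points \<open>s = 0, t, \<dots>, 4t\<close>. The same operator applied to \<open>s\<^sup>a\<close> scales exactly: it gives
\<open>t\<^sup>a p(Q)\<close>, where \<open>p(1) = 4\<^sup>a - 4 \<cdot> 3\<^sup>a + 6 \<cdot> 2\<^sup>a - 4\<close> is a fourth difference of \<open>x\<^sup>a\<close> and is positive for \<open>a\<close>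
near \<open>3/2\<close>. With \<open>4t = ln (1 + h)\<close> the points fill \<open>[1, 1 + h]\<close>, and the coefficients are bounded, so
the error is at least a constant times \<open>t\<^sup>a\<close>, hence times \<open>h\<^sup>a\<close>. The lemmas carrying this are
\<open>L0_kernel_representation\<close>, \<open>L0_kernel_annihilated\<close>, \<open>fourth_difference_pos\<close> and
\<open>log_power_distance_from_L0_kernel\<close>.

The exponent \<open>3/2\<close> is the threshold for membership in \<open>\<Lambda>\<^sub>0\<close>: the energy density near \<open>r = 1\<close> is of order
\<open>s\<^bsup>2a - 4\<^esup>\<close>, which is integrable exactly when \<open>a > 3/2\<close>. At infinity the powers of the logarithm are
harmless, since in the variable \<open>s\<close> the energy carries the weight \<open>e\<^bsup>-2s\<^esup>\<close> (\<open>log_power_in_Lambda0\<close>).\<close>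

section \<open>Absolute continuity\<close>

text \<open>The images of disjoint intervals under a monotone map are again disjoint, so the increments are
the lengths of disjoint intervals inside \<open>[K a, K b]\<close>.\<close>
lemma mono_increments_over_disjoint_intervals:
  fixes K :: "real \<Rightarrow> real" and N :: nat
  assumes mono: "mono_on {a..b} K" and ab: "a \<le> b"
    and uv: "\<And>i. i < N \<Longrightarrow> a \<le> u i \<and> u i \<le> v i \<and> v i \<le> b"
    and disj: "disjoint_family_on (\<lambda>i. {u i<..<v i}) {..<N}"
  shows "(\<Sum>i<N. K (v i) - K (u i)) \<le> K b - K a"
proof -
  have le: "K x \<le> K y" if "a \<le> x" "x \<le> y" "y \<le> b" for x y
    using mono_onD[OF mono] that by auto
  have disjK: "disjoint_family_on (\<lambda>i. {K (u i)<..<K (v i)}) {..<N}"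
    unfolding disjoint_family_on_def
  proof (intro ballI impI)
    fix i j assume ij: "i \<in> {..<N}" "j \<in> {..<N}" "i \<noteq> j"
    show "{K (u i)<..<K (v i)} \<inter> {K (u j)<..<K (v j)} = {}"
    proof (rule ccontr)
      assume "{K (u i)<..<K (v i)} \<inter> {K (u j)<..<K (v j)} \<noteq> {}"
      then have lt: "K (u i) < K (v j)" "K (u j) < K (v i)" "K (u i) < K (v i)" "K (u j) < K (v j)"
        by auto
      then have "u i < v j" "u j < v i" "u i < v i" "u j < v j"
        using uv[of i] uv[of j] le[of "v j" "u i"] le[of "v i" "u j"] le[of "v i" "u i"] le[of "v j" "u j"] ij
        by force+
      then have "(max (u i) (u j) + min (v i) (v j)) / 2 \<in> {u i<..<v i} \<inter> {u j<..<v j}"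
        by (auto simp: max_def min_def)
      then show False using disj ij unfolding disjoint_family_on_def by blast
    qed
  qed
  have "(\<Sum>i<N. K (v i) - K (u i)) = (\<Sum>i<N. measure lborel {K (u i)<..<K (v i)})"
    using uv le by (intro sum.cong) auto
  also have "\<dots> = measure lborel (\<Union>i<N. {K (u i)<..<K (v i)})"
    using uv le by (intro measure_finite_Union[symmetric] disjK) (auto simp: emeasure_lborel_Ioo)
  also have "\<dots> \<le> measure lborel {K a..K b}"
  proof (rule measure_mono_fmeasurable)
    show "(\<Union>i<N. {K (u i)<..<K (v i)}) \<subseteq> {K a..K b}"
    proof
      fix x assume "x \<in> (\<Union>i<N. {K (u i)<..<K (v i)})"
      then obtain i where "i < N" "K (u i) < x" "x < K (v i)" by auto
      then show "x \<in> {K a..K b}" using uv[of i] le[of a "u i"] le[of "v i" b] by auto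
    qed
  qed (auto simp: fmeasurable_def emeasure_lborel_Icc_eq)
  also have "\<dots> = K b - K a" using le[of a b] ab by simp
  finally show ?thesis .
qed

text \<open>A criterion that avoids integrating a derivative: up to an arbitrarily small monotone part,
the function is Lipschitz.\<close>
lemma abs_continuous_on_intervalI:
  fixes g :: "real \<Rightarrow> complex"
  assumes ab: "a \<le> b"
    and split: "\<And>e. e > 0 \<Longrightarrow> \<exists>K L. mono_on {a..b} K \<and> K b - K a < e \<and>
      (\<forall>u v. a \<le> u \<longrightarrow> u \<le> v \<longrightarrow> v \<le> b \<longrightarrow> norm (g v - g u) \<le> K v - K u + L * (v - u))"
  shows "abs_continuous_on_interval a b g"
  unfolding abs_continuous_on_interval_def
proof (intro allI impI)
  fix e :: real assume e: "e > 0"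
  then obtain K L where mono: "mono_on {a..b} K" and small: "K b - K a < e / 2"
    and bound: "\<And>u v. a \<le> u \<Longrightarrow> u \<le> v \<Longrightarrow> v \<le> b \<Longrightarrow> norm (g v - g u) \<le> K v - K u + L * (v - u)"
    using split[of "e / 2"] by auto
  let ?d = "e / (2 * (\<bar>L\<bar> + 1))"
  show "\<exists>d>0. \<forall>(N::nat) u v.
       (\<forall>i<N. a \<le> u i \<and> u i \<le> v i \<and> v i \<le> b) \<longrightarrow>
       disjoint_family_on (\<lambda>i. {u i<..<v i}) {..<N} \<longrightarrow>
       (\<Sum>i<N. v i - u i) < d \<longrightarrow> (\<Sum>i<N. norm (g (v i) - g (u i))) < e"
  proof (intro exI[of _ ?d] conjI allI impI)
    show "?d > 0" using e by simp
    fix N :: nat and u v :: "nat \<Rightarrow> real"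
    assume uv: "\<forall>i<N. a \<le> u i \<and> u i \<le> v i \<and> v i \<le> b"
      and disj: "disjoint_family_on (\<lambda>i. {u i<..<v i}) {..<N}"
      and len: "(\<Sum>i<N. v i - u i) < ?d"
    have len0: "0 \<le> (\<Sum>i<N. v i - u i)" using uv by (intro sum_nonneg) auto
    have "(\<Sum>i<N. norm (g (v i) - g (u i))) \<le> (\<Sum>i<N. (K (v i) - K (u i)) + L * (v i - u i))"
      using uv by (intro sum_mono bound) auto
    also have "\<dots> = (\<Sum>i<N. K (v i) - K (u i)) + L * (\<Sum>i<N. v i - u i)"
      by (simp add: sum.distrib sum_distrib_left)
    also have "(\<Sum>i<N. K (v i) - K (u i)) \<le> K b - K a"
      using uv by (intro mono_increments_over_disjoint_intervals[OF mono ab _ disj]) auto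
    also have "L * (\<Sum>i<N. v i - u i) \<le> (\<bar>L\<bar> + 1) * ?d"
      using len0 len by (intro mult_mono) auto
    also have "(\<bar>L\<bar> + 1) * ?d = e / 2" by (simp add: field_simps)
    finally show "(\<Sum>i<N. norm (g (v i) - g (u i))) < e" using small by simp
  qed
qed

lemma abs_continuous_log_power:
  fixes b A B :: real
  assumes b: "0 < b" "b < 1" and AB: "0 < A" "A < B"
  shows "abs_continuous_on_interval A B (\<lambda>r. of_real (max 0 (ln r) powr b))"
proof (rule abs_continuous_on_intervalI)
  show "A \<le> B" using AB by simp
  fix e :: real assume e: "e > 0"
  \<comment> \<open>Below \<open>\<eta>\<close> the power is monotone with total increment at most \<open>\<eta>\<^sup>b < e\<close>; above \<open>\<eta>\<close> it is Lipschitz.\<close>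
  define \<eta> where "\<eta> = (e / 2) powr (1 / b)"
  have \<eta>: "\<eta> > 0" "\<eta> powr b < e" using e b by (simp_all add: \<eta>_def powr_powr)
  define K where "K r = (min \<eta> (max 0 (ln r))) powr b" for r
  define L where "L = b * \<eta> powr (b - 1) / A"
  have mono: "K x \<le> K y" if "A \<le> x" "x \<le> y" for x y
    unfolding K_def using that AB b \<eta> by (intro powr_mono2 min.mono max.mono) auto
  have lip: "y powr b - x powr b \<le> b * \<eta> powr (b - 1) * (y - x)" if xy: "\<eta> \<le> x" "x \<le> y" for x y
  proof (cases "x = y")
    case False
    then have "x < y" using xy by simp
    then obtain z where z: "z > x" "z < y" "y powr b - x powr b = (y - x) * (b * z powr (b - 1))"
      using MVT2[of x y "\<lambda>x. x powr b" "\<lambda>z. b * z powr (b - 1)"] has_real_derivative_powr xy \<eta> by (metis less_le_trans)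
    have "z powr (b - 1) \<le> \<eta> powr (b - 1)" using z xy \<eta> b by (intro powr_mono2') auto
    then have "(y - x) * (b * z powr (b - 1)) \<le> (y - x) * (b * \<eta> powr (b - 1))"
      using b z by (intro mult_left_mono) auto
    then show ?thesis using z by (simp add: mult_ac)
  qed simp
  have incr: "norm (of_real (max 0 (ln v) powr b) - of_real (max 0 (ln u) powr b) :: complex)
      \<le> K v - K u + L * (v - u)" if uv: "A \<le> u" "u \<le> v" for u v
  proof -
    have eq: "max 0 s powr b = (min \<eta> (max 0 s)) powr b + ((max \<eta> s) powr b - \<eta> powr b)" for s
      using \<eta> by (auto simp: min_def max_def)
    have ln: "ln u \<le> ln v" using uv AB by simp
    have ln_le: "ln v - ln u \<le> (v - u) / A"
    proof -
      have "ln v - ln u = ln (v / u)" using uv AB by (simp add: ln_div)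
      also have "\<dots> \<le> v / u - 1" using uv AB by (intro ln_le_minus_one) auto
      also have "\<dots> = (v - u) / u" using uv AB by (simp add: field_simps)
      also have "\<dots> \<le> (v - u) / A" using uv AB by (intro divide_left_mono) auto
      finally show ?thesis .
    qed
    have "max \<eta> (ln v) powr b - max \<eta> (ln u) powr b
        \<le> b * \<eta> powr (b - 1) * (max \<eta> (ln v) - max \<eta> (ln u))"
      using ln by (intro lip) auto
    also have "\<dots> \<le> b * \<eta> powr (b - 1) * ((v - u) / A)"
      using ln ln_le b by (intro mult_left_mono) (auto simp: max_def)
    also have "\<dots> = L * (v - u)" by (simp add: L_def)
    finally have *: "max \<eta> (ln v) powr b - max \<eta> (ln u) powr b \<le> L * (v - u)" .
    have "max 0 (ln u) powr b \<le> max 0 (ln v) powr b"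
      using ln b by (intro powr_mono2) auto
    then have "norm (of_real (max 0 (ln v) powr b) - of_real (max 0 (ln u) powr b) :: complex)
      = max 0 (ln v) powr b - max 0 (ln u) powr b"
      by (simp flip: of_real_diff)
    also have "\<dots> \<le> K v - K u + L * (v - u)"
      using * eq[of "ln v"] eq[of "ln u"] unfolding K_def by linarith
    finally show ?thesis .
  qed
  have "K B - K A \<le> \<eta> powr b"
  proof -
    have "K B \<le> \<eta> powr b" unfolding K_def using b \<eta> by (intro powr_mono2) auto
    moreover have "K A \<ge> 0" by (simp add: K_def)
    ultimately show ?thesis by simp
  qed
  then have "K B - K A < e" using \<eta> by simp
  then show "\<exists>K L. mono_on {A..B} K \<and> K B - K A < e \<and>
      (\<forall>u v. A \<le> u \<longrightarrow> u \<le> v \<longrightarrow> v \<le> B \<longrightarrow>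
        norm (of_real (max 0 (ln v) powr b) - of_real (max 0 (ln u) powr b) :: complex) \<le> K v - K u + L * (v - u))"
    using mono incr by (intro exI[of _ K] exI[of _ L]) (auto intro!: mono_onI)
qed

lemma abs_continuous_mult_lipschitz:
  fixes g k :: "real \<Rightarrow> complex"
  assumes g: "abs_continuous_on_interval a b g"
    and k: "\<And>u v. a \<le> u \<Longrightarrow> u \<le> v \<Longrightarrow> v \<le> b \<Longrightarrow> norm (k v - k u) \<le> L * (v - u)"
    and Bg: "\<And>u. a \<le> u \<Longrightarrow> u \<le> b \<Longrightarrow> norm (g u) \<le> Bg"
    and Bk: "\<And>u. a \<le> u \<Longrightarrow> u \<le> b \<Longrightarrow> norm (k u) \<le> Bk"
  shows "abs_continuous_on_interval a b (\<lambda>r. g r * k r)"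
  unfolding abs_continuous_on_interval_def
proof (intro allI impI)
  fix e :: real assume e: "e > 0"
  define e1 where "e1 = e / (2 * (\<bar>Bk\<bar> + 1))"
  have e1: "e1 > 0" using e by (simp add: e1_def)
  then obtain d where d: "d > 0" and dg: "\<And>(N::nat) u v.
       (\<forall>i<N. a \<le> u i \<and> u i \<le> v i \<and> v i \<le> b) \<Longrightarrow>
       disjoint_family_on (\<lambda>i. {u i<..<v i}) {..<N} \<Longrightarrow>
       (\<Sum>i<N. v i - u i) < d \<Longrightarrow> (\<Sum>i<N. norm (g (v i) - g (u i))) < e1"
    using g unfolding abs_continuous_on_interval_def by meson
  define C where "C = \<bar>Bg\<bar> * \<bar>L\<bar> + 1"
  have C: "C > 0" by (simp add: C_def add_nonneg_pos)
  let ?d = "min d (e / (2 * C))"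
  show "\<exists>d>0. \<forall>(N::nat) u v.
       (\<forall>i<N. a \<le> u i \<and> u i \<le> v i \<and> v i \<le> b) \<longrightarrow>
       disjoint_family_on (\<lambda>i. {u i<..<v i}) {..<N} \<longrightarrow>
       (\<Sum>i<N. v i - u i) < d \<longrightarrow> (\<Sum>i<N. norm (g (v i) * k (v i) - g (u i) * k (u i))) < e"
  proof (intro exI[of _ ?d] conjI allI impI)
    show "?d > 0" using e d C by simp
    fix N :: nat and u v :: "nat \<Rightarrow> real"
    assume uv: "\<forall>i<N. a \<le> u i \<and> u i \<le> v i \<and> v i \<le> b"
      and disj: "disjoint_family_on (\<lambda>i. {u i<..<v i}) {..<N}"
      and len: "(\<Sum>i<N. v i - u i) < ?d"
    have incr: "norm (g (v i) * k (v i) - g (u i) * k (u i))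
        \<le> (\<bar>Bk\<bar> + 1) * norm (g (v i) - g (u i)) + C * (v i - u i)" if "i < N" for i
    proof -
      have i: "a \<le> u i" "u i \<le> v i" "v i \<le> b" using uv that by auto
      have "norm (g (v i) * k (v i) - g (u i) * k (u i))
          = norm (k (v i) * (g (v i) - g (u i)) + g (u i) * (k (v i) - k (u i)))"
        by (simp add: algebra_simps)
      also have "\<dots> \<le> norm (k (v i)) * norm (g (v i) - g (u i)) + norm (g (u i)) * norm (k (v i) - k (u i))"
        by (metis norm_triangle_ineq norm_mult)
      also have "norm (k (v i)) * norm (g (v i) - g (u i)) \<le> (\<bar>Bk\<bar> + 1) * norm (g (v i) - g (u i))"
        using Bk[of "v i"] i by (intro mult_right_mono) auto
      also have "norm (g (u i)) * norm (k (v i) - k (u i)) \<le> \<bar>Bg\<bar> * (\<bar>L\<bar> * (v i - u i))"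
      proof (rule mult_mono)
        show "norm (g (u i)) \<le> \<bar>Bg\<bar>" using Bg[of "u i"] i by simp
        have "L * (v i - u i) \<le> \<bar>L\<bar> * (v i - u i)" using i by (intro mult_right_mono) auto
        then show "norm (k (v i) - k (u i)) \<le> \<bar>L\<bar> * (v i - u i)" using k[of "u i" "v i"] i by simp
      qed simp_all
      also have "\<bar>Bg\<bar> * (\<bar>L\<bar> * (v i - u i)) \<le> C * (v i - u i)"
        using i by (simp add: C_def algebra_simps)
      finally show ?thesis by simp
    qed
    have "(\<Sum>i<N. norm (g (v i) * k (v i) - g (u i) * k (u i)))
        \<le> (\<Sum>i<N. (\<bar>Bk\<bar> + 1) * norm (g (v i) - g (u i)) + C * (v i - u i))"
      by (intro sum_mono incr) auto
    also have "\<dots> = (\<bar>Bk\<bar> + 1) * (\<Sum>i<N. norm (g (v i) - g (u i))) + C * (\<Sum>i<N. v i - u i)"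
      by (simp add: sum.distrib sum_distrib_left)
    also have "\<dots> < (\<bar>Bk\<bar> + 1) * e1 + C * (e / (2 * C))"
    proof (rule add_strict_mono)
      show "(\<bar>Bk\<bar> + 1) * (\<Sum>i<N. norm (g (v i) - g (u i))) < (\<bar>Bk\<bar> + 1) * e1"
        using dg[OF uv disj] len by (intro mult_strict_left_mono) auto
      show "C * (\<Sum>i<N. v i - u i) < C * (e / (2 * C))"
        using len C by (intro mult_strict_left_mono) auto
    qed
    also have "(\<bar>Bk\<bar> + 1) * e1 + C * (e / (2 * C)) = e"
      using C unfolding e1_def by (simp add: field_simps)
    finally show "(\<Sum>i<N. norm (g (v i) * k (v i) - g (u i) * k (u i))) < e" .
  qed
qed

lemma abs_continuous_on_interval_cong:
  assumes "abs_continuous_on_interval a b g" and eq: "\<And>r. a \<le> r \<Longrightarrow> r \<le> b \<Longrightarrow> f r = g r"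
  shows "abs_continuous_on_interval a b f"
  unfolding abs_continuous_on_interval_def
proof (intro allI impI)
  fix e :: real assume "e > 0"
  then obtain d where d: "d > 0" and dg: "\<And>(N::nat) u v.
       (\<forall>i<N. a \<le> u i \<and> u i \<le> v i \<and> v i \<le> b) \<Longrightarrow>
       disjoint_family_on (\<lambda>i. {u i<..<v i}) {..<N} \<Longrightarrow>
       (\<Sum>i<N. v i - u i) < d \<Longrightarrow> (\<Sum>i<N. norm (g (v i) - g (u i))) < e"
    using assms(1) unfolding abs_continuous_on_interval_def by meson
  show "\<exists>d>0. \<forall>(N::nat) u v.
       (\<forall>i<N. a \<le> u i \<and> u i \<le> v i \<and> v i \<le> b) \<longrightarrow>
       disjoint_family_on (\<lambda>i. {u i<..<v i}) {..<N} \<longrightarrow>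
       (\<Sum>i<N. v i - u i) < d \<longrightarrow> (\<Sum>i<N. norm (f (v i) - f (u i))) < e"
  proof (intro exI[of _ d] conjI allI impI d)
    fix N :: nat and u v :: "nat \<Rightarrow> real"
    assume uv: "\<forall>i<N. a \<le> u i \<and> u i \<le> v i \<and> v i \<le> b"
      and "disjoint_family_on (\<lambda>i. {u i<..<v i}) {..<N}" "(\<Sum>i<N. v i - u i) < d"
    then have "(\<Sum>i<N. norm (g (v i) - g (u i))) < e" by (rule dg)
    also have "(\<Sum>i<N. norm (g (v i) - g (u i))) = (\<Sum>i<N. norm (f (v i) - f (u i)))"
    proof (rule sum.cong)
      fix i assume "i \<in> {..<N}"
      then have "a \<le> u i" "u i \<le> v i" "v i \<le> b" using uv by auto
      then show "norm (g (v i) - g (u i)) = norm (f (v i) - f (u i))"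
        using eq[of "u i"] eq[of "v i"] by simp
    qed simp
    finally show "(\<Sum>i<N. norm (f (v i) - f (u i))) < e" .
  qed
qed

section \<open>Powers of the logarithm in the energy space\<close>

lemma powr_pos_part_has_real_derivative:
  fixes b :: real
  assumes "b > 1"
  shows "((\<lambda>x. max 0 x powr b) has_real_derivative b * max 0 x powr (b - 1)) (at x)"
proof -
  consider "x > 0" | "x < 0" | "x = 0" by linarith
  then show ?thesis
  proof cases
    case 1
    then have "((\<lambda>x. x powr b) has_real_derivative b * x powr (b - 1)) (at x)"
      by (rule has_real_derivative_powr)
    then show ?thesis using 1
      by (auto intro: has_field_derivative_transform_within_open[where S="{0<..}"])
  next
    case 2
    have "((\<lambda>x. 0) has_real_derivative 0) (at x)" by simp
    from has_field_derivative_transform_within_open[OF this, of "{..<0}" "\<lambda>x. max 0 x powr b"]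
    show ?thesis using 2 assms by (simp add: max_absorb1)
  next
    case 3
    have "((\<lambda>h. \<bar>h\<bar> powr (b - 1)) \<longlongrightarrow> \<bar>0\<bar> powr (b - 1)) (at (0::real))"
      using assms by (intro tendsto_powr' tendsto_intros) auto
    then have lim: "((\<lambda>h. \<bar>h\<bar> powr (b - 1)) \<longlongrightarrow> 0) (at (0::real))" using assms by simp
    have "((\<lambda>h. max 0 h powr b / h) \<longlongrightarrow> 0) (at (0::real))"
    proof (rule Lim_null_comparison[OF _ lim], rule always_eventually, rule allI)
      fix h :: real
      show "norm (max 0 h powr b / h) \<le> \<bar>h\<bar> powr (b - 1)"
        proof (cases "h > 0")
        case True
        then show ?thesis by (simp add: powr_diff)
      next
        case False
        then have "max 0 h = 0" by simp
        then show ?thesis by simp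
      qed
    qed
    then show ?thesis using 3 assms by (simp add: DERIV_def)
  qed
qed

text \<open>The integrand is the energy density of \<open>(ln r)\<^sup>a\<close> on \<open>(1, \<infinity>)\<close>. It is dominated by a multiple of the
derivative of the bounded function \<open>(ln r / (1 + ln r))\<^bsup>2a - 3\<^esup>\<close>; this is where \<open>a > 3/2\<close> enters.\<close>
lemma integrable_log_power_energy:
  fixes a :: real
  assumes a: "3/2 < a" "a < 2"
  shows "set_integrable lborel {1<..} (\<lambda>r. a\<^sup>2 * (ln r powr (2 * a - 4) * ((a - 1 - ln r)\<^sup>2 + (ln r)\<^sup>2) / r ^ 3))"
proof -
  define k where "k = 2 * a - 3"
  have k: "0 < k" "k < 1" using a by (auto simp: k_def)
  \<comment> \<open>The inner function \<open>s / (1 + s)\<close> behaves like \<open>s\<close> at \<open>0\<close> and stays bounded at infinity, so \<open>F\<close> has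
    finite limits at both ends of \<open>(1, \<infinity>)\<close>.\<close>
  define F where "F r = (ln r / (1 + ln r)) powr k" for r :: real
  define \<phi> where "\<phi> r = k * (ln r / (1 + ln r)) powr (k - 1) * (1 / (r * (1 + ln r)\<^sup>2))" for r :: real
  have dF: "(F has_real_derivative \<phi> r) (at r)" if "r > 1" for r
  proof -
    have ln: "ln r > 0" using that by simp
    then have nz: "1 + ln r \<noteq> 0" by linarith
    have "((\<lambda>r. ln r / (1 + ln r)) has_real_derivative 1 / (r * (1 + ln r)\<^sup>2)) (at r)"
      using that nz
      by (auto intro!: derivative_eq_intros simp: field_simps power2_eq_square)
    moreover have "ln r / (1 + ln r) > 0" using ln by simp
    ultimately show ?thesis
      unfolding F_def \<phi>_def by (intro DERIV_chain2[OF has_real_derivative_powr])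
  qed
  have "set_integrable lborel (einterval 1 \<infinity>) \<phi>"
  proof (rule interval_integral_FTC_nonneg(1))
    show "DERIV F r :> \<phi> r" if "1 < ereal r" for r using dF[of r] that by simp
    show "isCont \<phi> r" if "1 < ereal r" for r
    proof -
      have r: "r > 1" using that by simp
      have nz: "1 + ln r \<noteq> 0" using ln_gt_zero[OF r] by linarith
      then have q: "ln r / (1 + ln r) \<noteq> 0" using r by simp
      have "isCont (\<lambda>r. ln r / (1 + ln r)) r" using r nz by (intro continuous_intros) simp_all
      then have "isCont (\<lambda>r. (ln r / (1 + ln r)) powr (k - 1)) r"
        using q unfolding isCont_def by (intro tendsto_powr tendsto_const)
      moreover have "isCont (\<lambda>r. 1 / (r * (1 + ln r)\<^sup>2)) r"
        using r nz by (intro continuous_intros) simp_all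
      ultimately show ?thesis unfolding \<phi>_def by (intro continuous_mult continuous_const)
    qed
    show "AE r in lborel. 1 < ereal r \<longrightarrow> ereal r < \<infinity> \<longrightarrow> 0 \<le> \<phi> r"
      using k by (intro always_eventually) (auto simp: \<phi>_def)
    have "(F \<longlongrightarrow> (ln 1 / (1 + ln 1)) powr k) (at_right 1)"
      unfolding F_def
    proof (rule tendsto_powr'[OF _ tendsto_const])
      show "((\<lambda>r::real. ln r / (1 + ln r)) \<longlongrightarrow> ln 1 / (1 + ln 1)) (at_right 1)"
        by (intro tendsto_intros) simp_all
      have "0 \<le> ln r / (1 + ln r)" if "1 < r" for r :: real using that by simp
      then have "\<forall>\<^sub>F r::real in at_right 1. 0 \<le> ln r / (1 + ln r)"
        by (intro eventually_mono[OF eventually_at_right_less])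
      then show "(ln 1 / (1 + ln 1) :: real) \<noteq> 0 \<or> 0 < k \<and> (\<forall>\<^sub>F r::real in at_right 1. 0 \<le> ln r / (1 + ln r))"
        using k by simp
    qed
    then show "((F \<circ> real_of_ereal) \<longlongrightarrow> 0) (at_right 1)"
      unfolding one_ereal_def using k by (simp add: ereal_tendsto_simps1)
    have "((\<lambda>r::real. ln r / (1 + ln r)) \<longlongrightarrow> 1) at_top" 
    proof (rule Lim_transform_eventually)
      have "((\<lambda>r::real. inverse (1 + ln r)) \<longlongrightarrow> 0) at_top"
        by (intro tendsto_inverse_0_at_top filterlim_tendsto_add_at_top[OF tendsto_const] ln_at_top)
      from tendsto_diff[OF tendsto_const[of 1] this]
      show "((\<lambda>r::real. 1 - inverse (1 + ln r)) \<longlongrightarrow> 1) at_top" by simp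
      have "1 - inverse (1 + ln r) = ln r / (1 + ln r)" if "r > 1" for r :: real
      proof -
        have "1 + ln r \<noteq> 0" using ln_gt_zero[OF that] by linarith
        then show ?thesis by (simp add: field_simps)
      qed
      then show "\<forall>\<^sub>F r::real in at_top. 1 - inverse (1 + ln r) = ln r / (1 + ln r)"
        using eventually_gt_at_top[of 1] by (rule eventually_mono[rotated])
    qed
    then have "(F \<longlongrightarrow> 1 powr k) at_top"
      unfolding F_def using k by (intro tendsto_powr tendsto_intros) auto
    then show "((F \<circ> real_of_ereal) \<longlongrightarrow> 1) (at_left \<infinity>)"
      by (simp add: ereal_tendsto_simps1)
  qed auto
  then have int: "set_integrable lborel {1<..} (\<lambda>r. (32 * a\<^sup>2 / k) * \<phi> r)"
    unfolding one_ereal_def by (intro set_integrable_mult_right) (simp add: einterval_def greaterThan_def)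
  show ?thesis
  proof (rule set_integrable_bound[OF int])
    show "set_borel_measurable lborel {1<..} (\<lambda>r. a\<^sup>2 * (ln r powr (2 * a - 4) * ((a - 1 - ln r)\<^sup>2 + (ln r)\<^sup>2) / r ^ 3))"
      unfolding set_borel_measurable_def by measurable
    show "AE r in lborel. r \<in> {1<..} \<longrightarrow>
      norm (a\<^sup>2 * (ln r powr (2 * a - 4) * ((a - 1 - ln r)\<^sup>2 + (ln r)\<^sup>2) / r ^ 3)) \<le> norm ((32 * a\<^sup>2 / k) * \<phi> r)"
    proof (intro always_eventually allI impI)
      fix r :: real assume "r \<in> {1<..}"
      then have r: "r > 1" by simp
      define s where "s = ln r"
      have s: "s > 0" "r = exp s" using r by (auto simp: s_def)
      \<comment> \<open>The factor \<open>r\<^sup>2 = e\<^bsup>2s\<^esup>\<close> left over from \<open>1 / r\<^sup>3\<close> absorbs a fourth power of \<open>1 + s\<close>.\<close>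
      have "1 + s \<le> 2 * exp (s / 2)" using exp_ge_add_one_self[of "s / 2"] s by linarith
      then have "(1 + s) ^ 4 \<le> (2 * exp (s / 2)) ^ 4" using s by (intro power_mono) auto
      also have "\<dots> = 16 * r\<^sup>2" using s by (simp add: power_mult_distrib flip: exp_of_nat_mult)
      finally have grow: "(1 + s) ^ 4 \<le> 16 * r\<^sup>2" .
      have "\<bar>a - 1 - s\<bar> \<le> \<bar>1 + s\<bar>" using a s by linarith
      then have "(a - 1 - s)\<^sup>2 \<le> (1 + s)\<^sup>2" by (simp only: abs_le_square_iff)
      moreover have "s\<^sup>2 \<le> (1 + s)\<^sup>2" using s by (intro power_mono) auto
      ultimately have "((a - 1 - s)\<^sup>2 + s\<^sup>2) * (1 + s)\<^sup>2 \<le> (2 * (1 + s)\<^sup>2) * (1 + s)\<^sup>2"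
        by (intro mult_right_mono) auto
      also have "\<dots> = 2 * (1 + s) ^ 4" by (simp add: power2_eq_square power4_eq_xxxx)
      also have "\<dots> \<le> 32 * r\<^sup>2" using grow by simp
      finally have poly: "((a - 1 - s)\<^sup>2 + s\<^sup>2) / r ^ 3 \<le> 32 / (r * (1 + s)\<^sup>2)"
        using r s by (simp add: divide_simps power2_eq_square power3_eq_cube mult_ac)
      have "s powr (k - 1) = (s / (1 + s)) powr (k - 1) * (1 + s) powr (k - 1)"
        using s by (simp flip: powr_mult)
      also have "\<dots> \<le> (s / (1 + s)) powr (k - 1) * 1"
        using s k powr_mono[of "k - 1" 0 "1 + s"] by (intro mult_left_mono) auto
      finally have pw: "s powr (k - 1) \<le> (s / (1 + s)) powr (k - 1)" by simp
      have "a\<^sup>2 * (s powr (k - 1) * (((a - 1 - s)\<^sup>2 + s\<^sup>2) / r ^ 3))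
          \<le> a\<^sup>2 * ((s / (1 + s)) powr (k - 1) * (32 / (r * (1 + s)\<^sup>2)))"
        using r by (intro mult_left_mono mult_mono pw poly) auto
      also have "\<dots> = (32 * a\<^sup>2 / k) * \<phi> r" using k by (simp add: \<phi>_def s_def)
      also have "a\<^sup>2 * (s powr (k - 1) * (((a - 1 - s)\<^sup>2 + s\<^sup>2) / r ^ 3))
          = a\<^sup>2 * (ln r powr (2 * a - 4) * ((a - 1 - ln r)\<^sup>2 + (ln r)\<^sup>2) / r ^ 3)"
        by (simp add: s_def k_def)
      finally have "a\<^sup>2 * (ln r powr (2 * a - 4) * ((a - 1 - ln r)\<^sup>2 + (ln r)\<^sup>2) / r ^ 3)
          \<le> (32 * a\<^sup>2 / k) * \<phi> r" .
      moreover have "0 \<le> a\<^sup>2 * (ln r powr (2 * a - 4) * ((a - 1 - ln r)\<^sup>2 + (ln r)\<^sup>2) / r ^ 3)"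
        using r by simp
      ultimately show "norm (a\<^sup>2 * (ln r powr (2 * a - 4) * ((a - 1 - ln r)\<^sup>2 + (ln r)\<^sup>2) / r ^ 3)) \<le> norm ((32 * a\<^sup>2 / k) * \<phi> r)"
        unfolding real_norm_def by linarith
    qed
  qed
qed

lemma log_power_in_Lambda0:
  fixes a :: real
  assumes a: "3/2 < a" "a < 2"
  shows "(\<lambda>r. of_real (max 0 (ln r) powr a)) \<in> Lambda0"
proof -
  define f where "f = (\<lambda>r. complex_of_real (max 0 (ln r) powr a))"
  define g where "g r = complex_of_real (max 0 (ln r) powr (a - 1)) * of_real (a / r)" for r
  have df: "(f has_vector_derivative g r) (at r)" if "r > 0" for r
  proof -
    have "((\<lambda>r. max 0 (ln r) powr a) has_real_derivative (a * max 0 (ln r) powr (a - 1)) * (1 / r)) (at r)"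
      using a that by (intro DERIV_chain2[OF powr_pos_part_has_real_derivative]) (auto intro!: derivative_eq_intros)
    then have "((\<lambda>r. complex_of_real (max 0 (ln r) powr a)) has_vector_derivative
        of_real (a * max 0 (ln r) powr (a - 1) * (1 / r))) (at r)"
      by (rule has_vector_derivative_of_real)
    then show ?thesis by (simp add: f_def g_def mult_ac)
  qed
  have dr1: "dr 1 f r = g r" if "r > 0" for r
    using vector_derivative_at[OF df[OF that]] by (simp add: dr_def)
  have dg0: "(g has_vector_derivative 0) (at r)" if "0 < r" "r < 1" for r
  proof (rule has_vector_derivative_transform_within_open)
    show "((\<lambda>r. 0) has_vector_derivative (0::complex)) (at r)" by simp
    show "0 = g s" if "s \<in> {0<..<1}" for s
    proof -
      have "max 0 (ln s) = 0" using that by simp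
      then show ?thesis by (simp add: g_def)
    qed
  qed (use that in auto)
  have dg1: "(g has_vector_derivative of_real (a * ln r powr (a - 2) * (a - 1 - ln r) / r\<^sup>2)) (at r)" if "1 < r" for r
  proof (rule has_vector_derivative_transform_within_open)
    have ln: "ln r > 0" using that by simp
    have "((\<lambda>r. ln r powr (a - 1)) has_real_derivative ((a - 1) * ln r powr (a - 1 - 1)) * (1 / r)) (at r)"
      using that by (intro DERIV_chain2[OF has_real_derivative_powr]) (auto intro!: derivative_eq_intros)
    moreover have "((\<lambda>r. a / r) has_real_derivative - a / r\<^sup>2) (at r)"
      using that by (auto intro!: derivative_eq_intros simp: power2_eq_square)
    ultimately have d: "((\<lambda>r. ln r powr (a - 1) * (a / r)) has_real_derivative
        ((a - 1) * ln r powr (a - 1 - 1)) * (1 / r) * (a / r) + (- a / r\<^sup>2) * ln r powr (a - 1)) (at r)"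
      by (rule DERIV_mult)
    have p: "ln r powr (a - 1) = ln r powr (a - 2) * ln r"
      using ln powr_add[of "ln r" "a - 2" 1] by simp
    have "((a - 1) * ln r powr (a - 1 - 1)) * (1 / r) * (a / r) + (- a / r\<^sup>2) * ln r powr (a - 1)
        = a * ln r powr (a - 2) * (a - 1 - ln r) / r\<^sup>2"
      unfolding p using that by (simp add: field_simps power2_eq_square)
    with d have "((\<lambda>r. ln r powr (a - 1) * (a / r)) has_real_derivative
        a * ln r powr (a - 2) * (a - 1 - ln r) / r\<^sup>2) (at r)" by metis
    then show "((\<lambda>r. complex_of_real (ln r powr (a - 1) * (a / r))) has_vector_derivative
        of_real (a * ln r powr (a - 2) * (a - 1 - ln r) / r\<^sup>2)) (at r)"
      by (rule has_vector_derivative_of_real)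
    show "complex_of_real (ln s powr (a - 1) * (a / s)) = g s" if "s \<in> {1<..}" for s
      using that by (simp add: g_def)
  qed (use that in auto)
  have dr2: "dr 2 f r = D" if "0 < r" "(g has_vector_derivative D) (at r)" for r D
  proof -
    have "(dr 1 f has_vector_derivative D) (at r)"
      by (rule has_vector_derivative_transform_within_open[OF that(2), of "{0<..}"]) (use that dr1 in auto)
    then have "vector_derivative (dr 1 f) (at r) = D" by (rule vector_derivative_at)
    then show ?thesis by (simp add: dr_def numeral_2_eq_2)
  qed
  have diff: "times_differentiable_on 1 f {0<..}"
    unfolding times_differentiable_on_def using df by (auto simp: dr_def intro: differentiableI_vector)
  have "continuous_on {0<..} g"
    unfolding g_def using a by (intro continuous_intros continuous_on_powr') auto
  then have cont: "continuous_on {0<..} (dr 1 f)"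
    by (rule continuous_on_cong[THEN iffD1, rotated 2]) (use dr1 in auto)
  have ac: "abs_continuous_on_interval A B (dr 1 f)" if AB: "0 < A" "A < B" for A B
  proof -
    have "abs_continuous_on_interval A B (\<lambda>r. of_real (max 0 (ln r) powr (a - 1)) * of_real (a / r))"
    proof (rule abs_continuous_mult_lipschitz)
      show "abs_continuous_on_interval A B (\<lambda>r. of_real (max 0 (ln r) powr (a - 1)))"
        using a AB by (intro abs_continuous_log_power) auto
      fix u assume u: "A \<le> u" "u \<le> B"
      show "norm (complex_of_real (a / u)) \<le> a / A"
        using u AB a by (simp add: norm_divide frac_le)
      show "norm (complex_of_real (max 0 (ln u) powr (a - 1))) \<le> max 0 (ln B) powr (a - 1)"
        using u AB a by (simp add: powr_mono2 max.coboundedI2)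
    next
      fix u v assume uv: "A \<le> u" "u \<le> v" "v \<le> B"
      have "norm (complex_of_real (a / v) - of_real (a / u)) = a / u - a / v"
        using uv AB a by (subst of_real_diff[symmetric], subst norm_of_real) (simp add: frac_le)
      also have "\<dots> = a / (u * v) * (v - u)" using uv AB by (simp add: field_simps)
      also have "\<dots> \<le> a / (A * A) * (v - u)"
        using uv AB a by (intro mult_right_mono divide_left_mono mult_mono) auto
      finally show "norm (complex_of_real (a / v) - of_real (a / u)) \<le> a / (A * A) * (v - u)" .
    qed
    then have "abs_continuous_on_interval A B g" unfolding g_def .
    then show ?thesis by (rule abs_continuous_on_interval_cong) (use AB dr1 in auto)
  qed
  let ?E = "\<lambda>r. r * (cmod (dr 2 f r))\<^sup>2 + 1 / r * (cmod (dr 1 f r))\<^sup>2"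
  have E0: "?E r = 0" if "0 < r" "r < 1" for r
  proof -
    have "max 0 (ln r) = 0" using that by simp
    then show ?thesis using dr2[OF _ dg0] that by (simp add: dr1 g_def del: One_nat_def)
  qed
  have E1: "?E r = a\<^sup>2 * (ln r powr (2 * a - 4) * ((a - 1 - ln r)\<^sup>2 + (ln r)\<^sup>2) / r ^ 3)" if "1 < r" for r
  proof -
    have ln: "ln r > 0" using that by simp
    have p1: "ln r powr (a - 1) = ln r powr (a - 2) * ln r"
      using ln powr_add[of "ln r" "a - 2" 1] by simp
    have p2: "ln r powr (2 * a - 4) = (ln r powr (a - 2))\<^sup>2"
      by (simp add: power2_eq_square flip: powr_add)
    have "cmod (dr 2 f r) = \<bar>a * ln r powr (a - 2) * (a - 1 - ln r) / r\<^sup>2\<bar>"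
      using dr2[OF _ dg1[OF that]] that by (simp del: of_real_mult of_real_diff of_real_divide of_real_power)
    moreover have "cmod (dr 1 f r) = \<bar>ln r powr (a - 2) * ln r * (a / r)\<bar>"
      using dr1[of r] that ln unfolding g_def
      by (simp add: p1 norm_mult norm_divide abs_mult del: One_nat_def)
    ultimately have "?E r = r * (a * ln r powr (a - 2) * (a - 1 - ln r) / r\<^sup>2)\<^sup>2 + 1 / r * (ln r powr (a - 2) * ln r * (a / r))\<^sup>2"
      by (simp only: power2_abs)
    also have "\<dots> = a\<^sup>2 * (ln r powr (2 * a - 4) * ((a - 1 - ln r)\<^sup>2 + (ln r)\<^sup>2) / r ^ 3)"
      unfolding p2 using that by (simp add: field_simps power2_eq_square power3_eq_cube)
    finally show ?thesis .
  qed
  have "set_integrable lebesgue {0<..} ?E"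
  proof -
    have cong: "set_integrable lebesgue S p" if "set_integrable lebesgue S q" "\<And>r. r \<in> S \<Longrightarrow> p r = q r"
      for S :: "real set" and p q :: "real \<Rightarrow> real"
    proof -
      have "(\<lambda>r. indicator S r *\<^sub>R p r) = (\<lambda>r. indicator S r *\<^sub>R q r)"
        using that(2) by (auto simp: indicator_def)
      then show ?thesis using that(1) by (simp add: set_integrable_def)
    qed
    have i0: "set_integrable lebesgue {0<..<1} ?E"
      by (rule cong[where q = "\<lambda>r. 0"]) (use E0 in \<open>auto simp: set_integrable_def\<close>)
    \<comment> \<open>At \<open>r = 1\<close> the second derivative does not exist, but a single point is a null set.\<close>
    have "set_integrable lebesgue {1} (\<lambda>r::real. ?E 1)"
      unfolding set_integrable_def by (intro integrable_scaleR_left integrable_real_indicator) auto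
    then have i1: "set_integrable lebesgue {1} ?E" by (rule cong) simp
    have "set_integrable lebesgue {1<..} (\<lambda>r. a\<^sup>2 * (ln r powr (2 * a - 4) * ((a - 1 - ln r)\<^sup>2 + (ln r)\<^sup>2) / r ^ 3))"
      using integrable_log_power_energy[OF a] unfolding set_integrable_def
      by (simp add: integrable_completion borel_measurable_integrable)
    then have i2: "set_integrable lebesgue {1<..} ?E" by (rule cong) (use E1 in auto)
    have "{0<..} = {0<..<1} \<union> {1} \<union> {1::real<..}" by auto
    then show ?thesis using set_integrable_Un[OF set_integrable_Un[OF i0 i1] i2] by simp
  qed
  then show ?thesis
    unfolding Lambda0_def using diff cont ac by (simp flip: f_def)
qed

section \<open>The kernel of the differential operator\<close>

lemma dr_has_vector_derivative:
  assumes "times_differentiable_on k y S" "r \<in> S" "i < k"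
  shows "(dr i y has_vector_derivative dr (Suc i) y r) (at r)"
  using assms by (auto simp: times_differentiable_on_def dr_def vector_derivative_works)

text \<open>In terms of \<open>\<theta> = r d/dr\<close> the equation reads \<open>\<theta>\<^sup>2 (\<theta> - 2)\<^sup>2 y = 0\<close>. Solving it once for \<open>(\<theta> - 2)\<^sup>2 y\<close> and
once for \<open>\<theta>\<^sup>2 y\<close> produces four first integrals, from which \<open>y\<close> is recovered by linear algebra.\<close>
lemma L0_kernel_representation:
  fixes y :: "real \<Rightarrow> complex"
  assumes diff: "times_differentiable_on 4 y {a<..<b}"
    and L0: "\<And>r. r \<in> {a<..<b} \<Longrightarrow> L0 y r = 0" and "0 < a"
  obtains A B C D where
    "\<And>r. r \<in> {a<..<b} \<Longrightarrow> y r = A + B * of_real (ln r) + of_real (r\<^sup>2) * (C + D * of_real (ln r))"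
proof -
  let ?S = "{a<..<b}"
  \<comment> \<open>With \<open>\<theta> = r d/dr\<close>: \<open>z = (\<theta> - 2)\<^sup>2 y\<close> and \<open>k1 = \<theta> z\<close>, while \<open>x = r^(-2) \<theta>\<^sup>2 y\<close> and \<open>k3 = \<theta> x\<close>.\<close>
  define k1 where "k1 r = of_real (r^3) * dr 3 y r - of_real (r\<^sup>2) * dr 2 y r + of_real r * dr 1 y r" for r
  define k3 where "k3 r = of_real r * dr 3 y r + dr 2 y r - of_real (1/r) * dr 1 y r" for r
  define z where "z r = of_real (r\<^sup>2) * dr 2 y r - of_real (3 * r) * dr 1 y r + 4 * dr 0 y r" for r
  define x where "x r = dr 2 y r + of_real (1/r) * dr 1 y r" for r
  have d: "(dr 0 y has_vector_derivative dr 1 y r) (at r)"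
      "(dr 1 y has_vector_derivative dr 2 y r) (at r)"
      "(dr 2 y has_vector_derivative dr 3 y r) (at r)"
      "(dr 3 y has_vector_derivative dr 4 y r) (at r)" if "r \<in> ?S" for r
    using dr_has_vector_derivative[OF diff that] by (auto simp: numeral_eq_Suc)
  have pos: "r > 0" if "r \<in> ?S" for r using that \<open>0 < a\<close> by auto
  note vd = has_vector_derivative_add has_vector_derivative_diff has_vector_derivative_mult
      has_vector_derivative_of_real has_vector_derivative_const d
  have L: "of_real r * dr 4 y r + 2 * dr 3 y r - of_real (1/r) * dr 2 y r
       + of_real (1/r\<^sup>2) * dr 1 y r = 0" if "r \<in> ?S" for r
    using L0[OF that] by (simp add: L0_def scaleR_conv_of_real)
  have k1d: "(k1 has_vector_derivative 0) (at r)" if r: "r \<in> ?S" for r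
  proof -
    have "(k1 has_vector_derivative
        of_real (r^3) * dr 4 y r + of_real (3 * r\<^sup>2) * dr 3 y r
        - (of_real (r\<^sup>2) * dr 3 y r + of_real (2 * r) * dr 2 y r)
        + (of_real r * dr 2 y r + of_real 1 * dr 1 y r)) (at r)"
      unfolding k1_def using pos[OF r]
      by (intro vd r) (auto intro!: derivative_eq_intros)
    also have "of_real (r^3) * dr 4 y r + of_real (3 * r\<^sup>2) * dr 3 y r
        - (of_real (r\<^sup>2) * dr 3 y r + of_real (2 * r) * dr 2 y r)
        + (of_real r * dr 2 y r + of_real 1 * dr 1 y r)
      = of_real (r\<^sup>2) * (of_real r * dr 4 y r + 2 * dr 3 y r - of_real (1/r) * dr 2 y r
       + of_real (1/r\<^sup>2) * dr 1 y r)"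
      using pos[OF r] by (simp add: field_simps power2_eq_square power3_eq_cube)
    finally show ?thesis by (simp only: L[OF r]) simp
  qed
  have k3d: "(k3 has_vector_derivative 0) (at r)" if r: "r \<in> ?S" for r
  proof -
    have "(k3 has_vector_derivative
        (of_real r * dr 4 y r + of_real 1 * dr 3 y r) + dr 3 y r
        - (of_real (1/r) * dr 2 y r + of_real (- 1 / r\<^sup>2) * dr 1 y r)) (at r)"
      unfolding k3_def using pos[OF r]
      by (intro vd r) (auto intro!: derivative_eq_intros simp: power2_eq_square)
    also have "(of_real r * dr 4 y r + of_real 1 * dr 3 y r) + dr 3 y r
        - (of_real (1/r) * dr 2 y r + of_real (- 1 / r\<^sup>2) * dr 1 y r)
      = of_real r * dr 4 y r + 2 * dr 3 y r - of_real (1/r) * dr 2 y r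
       + of_real (1/r\<^sup>2) * dr 1 y r"
      by (simp add: algebra_simps)
    finally show ?thesis by (simp only: L[OF r])
  qed
  have const: "\<exists>c. \<forall>r\<in>?S. g r = c" if "\<And>r. r \<in> ?S \<Longrightarrow> (g has_vector_derivative 0) (at r)" for g :: "real \<Rightarrow> complex"
    using has_vector_derivative_zero_constant[of ?S g]
    by (metis convex_real_interval(8) has_vector_derivative_at_within that)
  obtain K1 where K1: "\<And>r. r \<in> ?S \<Longrightarrow> k1 r = K1" using const[OF k1d] by blast
  obtain K3 where K3: "\<And>r. r \<in> ?S \<Longrightarrow> k3 r = K3" using const[OF k3d] by blast
  have k2d: "((\<lambda>r. z r - of_real (ln r) * K1) has_vector_derivative 0) (at r)" if r: "r \<in> ?S" for r
  proof -
    have "((\<lambda>r. z r - of_real (ln r) * K1) has_vector_derivative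
        (of_real (r\<^sup>2) * dr 3 y r + of_real (2 * r) * dr 2 y r)
        - (of_real (3 * r) * dr 2 y r + of_real 3 * dr 1 y r) + (4 * dr 1 y r + 0 * dr 0 y r)
        - (of_real (ln r) * 0 + of_real (1/r) * K1)) (at r)"
      unfolding z_def using pos[OF r]
      by (intro vd r) (auto intro!: derivative_eq_intros simp: power2_eq_square)
    also have "(of_real (r\<^sup>2) * dr 3 y r + of_real (2 * r) * dr 2 y r)
        - (of_real (3 * r) * dr 2 y r + of_real 3 * dr 1 y r) + (4 * dr 1 y r + 0 * dr 0 y r)
        - (of_real (ln r) * 0 + of_real (1/r) * K1) = 0"
      using pos[OF r] unfolding K1[OF r, symmetric] k1_def
      by (simp add: field_simps power2_eq_square power3_eq_cube)
    finally show ?thesis .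
  qed
  have k4d: "((\<lambda>r. x r - of_real (ln r) * K3) has_vector_derivative 0) (at r)" if r: "r \<in> ?S" for r
  proof -
    have "((\<lambda>r. x r - of_real (ln r) * K3) has_vector_derivative
        dr 3 y r + (of_real (1/r) * dr 2 y r + of_real (- 1 / r\<^sup>2) * dr 1 y r)
        - (of_real (ln r) * 0 + of_real (1/r) * K3)) (at r)"
      unfolding x_def using pos[OF r]
      by (intro vd r) (auto intro!: derivative_eq_intros simp: power2_eq_square)
    also have "dr 3 y r + (of_real (1/r) * dr 2 y r + of_real (- 1 / r\<^sup>2) * dr 1 y r)
        - (of_real (ln r) * 0 + of_real (1/r) * K3) = 0"
      using pos[OF r] unfolding K3[OF r, symmetric] k3_def
      by (simp add: field_simps power2_eq_square power3_eq_cube)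
    finally show ?thesis .
  qed
  obtain K2 where K2: "\<And>r. r \<in> ?S \<Longrightarrow> z r - of_real (ln r) * K1 = K2" using const[OF k2d] by blast
  obtain K4 where K4: "\<And>r. r \<in> ?S \<Longrightarrow> x r - of_real (ln r) * K3 = K4" using const[OF k4d] by blast
  have "y r = (K1 / 4 + K2 / 4) + K1 / 4 * of_real (ln r)
      + of_real (r\<^sup>2) * ((K4 / 4 - K3 / 4) + K3 / 4 * of_real (ln r))" if r: "r \<in> ?S" for r
  proof -
    have "4 * y r = z r + of_real (r\<^sup>2) * x r + k1 r - of_real (r\<^sup>2) * k3 r"
      using pos[OF r] unfolding z_def x_def k1_def k3_def
      by (simp add: field_simps power2_eq_square power3_eq_cube dr_def)
    also have "z r = of_real (ln r) * K1 + K2" using K2[OF r] by (simp add: algebra_simps)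
    also have "x r = of_real (ln r) * K3 + K4" using K4[OF r] by (simp add: algebra_simps)
    finally have "4 * y r = 4 * ((K1 / 4 + K2 / 4) + K1 / 4 * of_real (ln r)
      + of_real (r\<^sup>2) * ((K4 / 4 - K3 / 4) + K3 / 4 * of_real (ln r)))"
      unfolding K1[OF r] K3[OF r] by (simp add: algebra_simps)
    then show ?thesis by (metis mult_cancel_left zero_neq_numeral)
  qed
  then show thesis by (rule that)
qed

text \<open>The characteristic polynomial \<open>(x - 1)\<^sup>2 (x - q)\<^sup>2\<close> has the double roots \<open>1\<close> and \<open>q\<close>, so its recurrence kills
\<open>A + B j T + q\<^sup>j (C + D j T)\<close> as a function of \<open>j\<close>.\<close>
lemma double_root_recurrence:
  fixes A B C D T q :: complex
  shows "(A + B * (4 * T) + q ^ 4 * (C + D * (4 * T)))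
    - (2 * q + 2) * (A + B * (3 * T) + q ^ 3 * (C + D * (3 * T)))
    + (q\<^sup>2 + 4 * q + 1) * (A + B * (2 * T) + q\<^sup>2 * (C + D * (2 * T)))
    - (2 * q\<^sup>2 + 2 * q) * (A + B * T + q * (C + D * T)) + q\<^sup>2 * (A + C) = 0"
  by (simp add: algebra_simps power2_eq_square power3_eq_cube power4_eq_xxxx)

lemma L0_kernel_annihilated:
  fixes A B C D :: complex and t :: real
  defines "s \<equiv> \<lambda>r. A + B * of_real (ln r) + of_real (r\<^sup>2) * (C + D * of_real (ln r))"
    and "Q \<equiv> exp (2 * t)"
  shows "s (exp (4 * t)) - (2 * Q + 2) * s (exp (3 * t)) + (Q\<^sup>2 + 4 * Q + 1) * s (exp (2 * t))
      - (2 * Q\<^sup>2 + 2 * Q) * s (exp t) + Q\<^sup>2 * s 1 = 0"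
proof -
  have e: "(exp (real k * t))\<^sup>2 = Q ^ k" for k
    unfolding Q_def by (simp flip: exp_of_nat_mult add: mult_ac)
  have "(exp (4 * t))\<^sup>2 = Q ^ 4" "(exp (3 * t))\<^sup>2 = Q ^ 3" "(exp (2 * t))\<^sup>2 = Q ^ 2" "(exp t)\<^sup>2 = Q"
    using e[of 4] e[of 3] e[of 2] e[of 1] by simp_all
  then have "s (exp (4 * t)) = A + B * (4 * of_real t) + of_real Q ^ 4 * (C + D * (4 * of_real t))"
    "s (exp (3 * t)) = A + B * (3 * of_real t) + of_real Q ^ 3 * (C + D * (3 * of_real t))"
    "s (exp (2 * t)) = A + B * (2 * of_real t) + of_real Q ^ 2 * (C + D * (2 * of_real t))"
    "s (exp t) = A + B * of_real t + of_real Q * (C + D * of_real t)"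
    "s 1 = A + C"
    unfolding s_def by simp_all
  note vals = this
  show ?thesis
    unfolding vals of_real_add of_real_mult of_real_power of_real_numeral of_real_1
    by (rule double_root_recurrence)
qed

section \<open>Distance of the logarithmic power from the kernel\<close>

text \<open>At \<open>a = 3/2\<close> the value is \<open>8 - 12 \<cdot> sqrt 3 + 12 \<cdot> sqrt 2 - 4 = 4 - 12 (sqrt 3 - sqrt 2) > 0\<close>; continuity
extends this to nearby exponents.\<close>
lemma fourth_difference_pos:
  obtains a0 :: real where "a0 > 3/2" "a0 < 2"
    "\<And>a. 3/2 \<le> a \<Longrightarrow> a \<le> a0 \<Longrightarrow> 4 powr a - 4 * 3 powr a + 6 * 2 powr a - 4 > 0"
proof -
  let ?p = "\<lambda>a. 4 powr a - 4 * 3 powr a + 6 * 2 powr a - (4::real)"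
  have h: "x powr (3/2) = x * sqrt x" if "x > 0" for x :: real
    using powr_add[of x 1 "1/2"] that by (simp add: powr_half_sqrt)
  have "sqrt 3 < 1.7321" by (rule real_less_lsqrt) (simp_all add: power2_eq_square)
  moreover have "sqrt 2 > 1.4142" by (rule real_less_rsqrt) (simp add: power2_eq_square)
  ultimately have "?p (3/2) > 0" by (simp add: h)
  moreover have "isCont ?p (3/2)" by (intro continuous_intros) auto
  then have "(?p \<longlongrightarrow> ?p (3/2)) (nhds (3/2))"
    using tendsto_at_iff_tendsto_nhds[of ?p "3/2"] by (simp only: isCont_def)
  ultimately have "eventually (\<lambda>a. ?p a > 0) (nhds (3/2))"
    by (rule order_tendstoD(1)[rotated])
  then obtain d where d: "d > 0" "\<And>a. dist a (3/2) < d \<Longrightarrow> ?p a > 0"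
    unfolding eventually_nhds_metric by blast
  show thesis
  proof (rule that)
    show "3/2 + min (d/2) (1/4) > (3/2::real)" using d(1) by simp
    show "3/2 + min (d/2) (1/4) < (2::real)" by linarith
    fix a :: real assume "3/2 \<le> a" "a \<le> 3/2 + min (d/2) (1/4)"
    then have "dist a (3/2) < d" using d(1) by (simp add: dist_real_def)
    then show "?p a > 0" by (rule d(2))
  qed
qed

text \<open>The annihilating functional sees only the error \<open>f - s\<close>, but its value on \<open>f\<close> alone is explicit; the
constant 36 bounds the sum of the absolute values of its coefficients.\<close>
lemma log_power_distance_from_L0_kernel:
  fixes A B C D :: complex and a t m :: real
  defines "Q \<equiv> exp (2 * t)"
  assumes t: "0 \<le> t" "Q \<le> 2" and a: "0 < a"
    and close: "\<And>j. j \<le> 4 \<Longrightarrow> cmod (of_real (max 0 (ln (exp (real j * t))) powr a)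
      - (A + B * of_real (ln (exp (real j * t)))
         + of_real ((exp (real j * t))\<^sup>2) * (C + D * of_real (ln (exp (real j * t)))))) \<le> m"
  shows "t powr a * (4 powr a - (2 * Q + 2) * 3 powr a + (Q\<^sup>2 + 4 * Q + 1) * 2 powr a - (2 * Q\<^sup>2 + 2 * Q)) \<le> 36 * m"
proof -
  define s where "s r = A + B * of_real (ln r) + of_real (r\<^sup>2) * (C + D * of_real (ln r))" for r
  define F where "F r = complex_of_real (max 0 (ln r) powr a)" for r
  define d where "d j = F (exp (real j * t)) - s (exp (real j * t))" for j :: nat
  have d: "cmod (d j) \<le> m" if "j \<le> 4" for j
    using close[OF that] by (simp only: d_def F_def s_def)
  have Q: "1 \<le> Q" using t by (simp add: Q_def)
  have m: "0 \<le> m" using d[of 0] norm_ge_zero[of "d 0"] by linarith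
  have F: "F (exp (real j * t)) = of_real (real j powr a * t powr a)" for j
    using t by (simp add: F_def powr_mult max_absorb2)
  define X where "X = t powr a * (4 powr a - (2 * Q + 2) * 3 powr a + (Q\<^sup>2 + 4 * Q + 1) * 2 powr a - (2 * Q\<^sup>2 + 2 * Q))"
  have ann: "s (exp (4 * t)) - (2 * Q + 2) * s (exp (3 * t)) + (Q\<^sup>2 + 4 * Q + 1) * s (exp (2 * t))
      - (2 * Q\<^sup>2 + 2 * Q) * s (exp t) + Q\<^sup>2 * s 1 = 0"
    using L0_kernel_annihilated[of A B t C D] unfolding s_def Q_def .
  have "F (exp (4 * t)) - (2 * Q + 2) * F (exp (3 * t)) + (Q\<^sup>2 + 4 * Q + 1) * F (exp (2 * t))
      - (2 * Q\<^sup>2 + 2 * Q) * F (exp t) + Q\<^sup>2 * F 1 = of_real X"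
    using F[of 4] F[of 3] F[of 2] F[of 1] F[of 0] a by (simp add: X_def algebra_simps)
  then have "of_real X = (F (exp (4 * t)) - (2 * Q + 2) * F (exp (3 * t)) + (Q\<^sup>2 + 4 * Q + 1) * F (exp (2 * t))
      - (2 * Q\<^sup>2 + 2 * Q) * F (exp t) + Q\<^sup>2 * F 1)
    - (s (exp (4 * t)) - (2 * Q + 2) * s (exp (3 * t)) + (Q\<^sup>2 + 4 * Q + 1) * s (exp (2 * t))
      - (2 * Q\<^sup>2 + 2 * Q) * s (exp t) + Q\<^sup>2 * s 1)"
    unfolding ann by simp
  then have X: "of_real X = d 4 - of_real (2 * Q + 2) * d 3 + of_real (Q\<^sup>2 + 4 * Q + 1) * d 2
      - of_real (2 * Q\<^sup>2 + 2 * Q) * d 1 + of_real (Q\<^sup>2) * d 0"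
    unfolding d_def by (simp add: algebra_simps)
  have n: "cmod (of_real c * d j) \<le> c * m" if "0 \<le> c" "j \<le> 4" for c j
    using d[OF that(2)] that(1) by (simp add: norm_mult mult_left_mono)
  have tri: "cmod (x1 - x2 + x3 - x4 + x5) \<le> cmod x1 + cmod x2 + cmod x3 + cmod x4 + cmod x5" for x1 x2 x3 x4 x5
    by (smt (verit) norm_triangle_ineq norm_triangle_ineq4)
  have "X \<le> cmod (of_real X)" by simp
  also have "\<dots> \<le> m + (2 * Q + 2) * m + (Q\<^sup>2 + 4 * Q + 1) * m + (2 * Q\<^sup>2 + 2 * Q) * m + Q\<^sup>2 * m"
    unfolding X using Q by (intro order_trans[OF tri] add_mono n d) auto
  \<comment> \<open>The absolute values of the coefficients of \<open>(x - 1)\<^sup>2 (x - Q)\<^sup>2\<close> add up to its value at \<open>x = -1\<close>.\<close>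
  also have "\<dots> = (2 * (1 + Q))\<^sup>2 * m" by (simp add: algebra_simps power2_eq_square)
  also have "\<dots> \<le> 6\<^sup>2 * m" using Q t m by (intro mult_right_mono power_mono) auto
  finally show ?thesis by (simp add: X_def)
qed

section \<open>The lower bound for splines\<close>

text \<open>An essential bound for a function holds everywhere on an interval for a continuous function that
agrees with it on the interior. The endpoints have to be included because the power of the
logarithm is sampled at its singularity, the left endpoint of the first subinterval.\<close>
lemma Linf_bound_pointwise:
  assumes E: "Linf_norm 1 2 g < ereal m" and uv: "1 \<le> u" "u < v" "v \<le> 2"
    and cont: "continuous_on {u..v} G" and eq: "\<And>r. r \<in> {u<..<v} \<Longrightarrow> g r = G r"
    and x: "x \<in> {u..v}"
  shows "cmod (G x) \<le> m"
proof -
  define A where "A = {r \<in> {u<..<v}. cmod (G r) \<le> m}"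
  have "AE r in lebesgue_on {1..2}. ereal (cmod (g r)) \<le> Linf_norm 1 2 g"
    unfolding Linf_norm_def by (rule esssup_AE)
  then have "AE r in lebesgue. r \<in> {1..2} \<longrightarrow> ereal (cmod (g r)) \<le> Linf_norm 1 2 g"
    by (subst (asm) AE_restrict_space_iff) auto
  then have "AE r \<in> {u<..<v} in lebesgue. r \<in> closure A"
  proof eventually_elim
    case (elim r)
    show ?case
    proof
      assume r: "r \<in> {u<..<v}"
      with elim uv have "ereal (cmod (g r)) \<le> Linf_norm 1 2 g" by auto
      then have "ereal (cmod (g r)) < ereal m" using E by (rule le_less_trans)
      then have "r \<in> A" using r eq by (auto simp: A_def)
      then show "r \<in> closure A" using closure_subset by blast
    qed
  qed
  then have "{u<..<v} \<subseteq> closure A"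
    by (intro subsetI mem_closed_if_AE_lebesgue_open[of "{u<..<v}" "closure A"]) simp_all
  then have "closure {u<..<v} \<subseteq> closure A" by (simp add: closure_minimal)
  then have sub: "{u..v} \<subseteq> closure A" using uv by simp
  have "closure A \<subseteq> {u..v}" by (rule closure_minimal) (auto simp: A_def)
  then have "continuous_on (closure A) G" by (rule continuous_on_subset[OF cont])
  then show ?thesis
    by (rule continuous_on_closure_norm_le) (use sub x in \<open>auto simp: A_def\<close>)
qed

theorem theorem7:
  fixes \<epsilon> :: real
  assumes "\<epsilon> > 0"
  shows "\<exists>f\<in>Lambda0. \<exists>M>0. \<exists>h0>0. \<forall>n\<ge>2. \<forall>h. h = 1 / (real n - 1) \<longrightarrow> h < h0 \<longrightarrow>
    (\<forall>\<sigma>\<in>S0 n (uniform_knots h).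
       ereal (M * h powr (3 / 2 + \<epsilon>)) \<le> Linf_norm 1 2 (\<lambda>r. f r - \<sigma> r))"
proof -
  obtain a0 :: real where a0: "a0 > 3/2" "a0 < 2"
    and pos: "\<And>a. 3/2 \<le> a \<Longrightarrow> a \<le> a0 \<Longrightarrow> 4 powr a - 4 * 3 powr a + 6 * 2 powr a - 4 > (0::real)"
    using fourth_difference_pos by blast
  \<comment> \<open>Since \<open>h \<le> 1\<close>, lowering the exponent only strengthens the claim, so \<open>a\<close> may be kept near \<open>3/2\<close>.\<close>
  define a where "a = min a0 (3/2 + \<epsilon>)"
  have a: "3/2 < a" "a < 2" "a \<le> 3/2 + \<epsilon>" using a0 assms by (auto simp: a_def)
  define p where "p Q = 4 powr a - (2 * Q + 2) * 3 powr a + (Q\<^sup>2 + 4 * Q + 1) * 2 powr a - (2 * Q\<^sup>2 + 2 * Q)" for Q :: real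
  have p1: "p 1 > 0" using pos[of a] a by (simp add: p_def a_def)
  have "isCont p 1" unfolding p_def by (intro continuous_intros)
  then obtain \<delta> where \<delta>: "\<delta> > 0" "\<And>Q. dist Q 1 < \<delta> \<Longrightarrow> dist (p Q) (p 1) < p 1 / 2"
    using p1 unfolding continuous_at_eps_delta by (metis half_gt_zero)
  \<comment> \<open>The spacing \<open>t = ln (1 + h) / 4\<close> is at least \<open>h / 8\<close>, and \<open>p\<close> is at least \<open>p 1 / 2\<close> near \<open>1\<close>, so an
    error \<open>m\<close> satisfies \<open>(h / 8)\<^sup>a p(1) / 2 \<le> 36 m\<close>; taking 80 in place of 72 makes the contradiction strict.\<close>
  define M where "M = p 1 / (80 * 8 powr a)"
  define f where "f r = complex_of_real (max 0 (ln r) powr a)" for r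
  have M: "M > 0" using p1 by (simp add: M_def)
  have "ereal (M * h powr (3 / 2 + \<epsilon>)) \<le> Linf_norm 1 2 (\<lambda>r. f r - \<sigma> r)"
    if n: "n \<ge> 2" and hn: "h = 1 / (real n - 1)" and h\<delta>: "h < min \<delta> (1 / 2)" and \<sigma>: "\<sigma> \<in> S0 n (uniform_knots h)" for n h \<sigma>
  proof (rule ccontr)
    have h: "0 < h" "h \<le> 1" using n unfolding hn by (auto simp: divide_simps)
    have h0: "h \<le> 1 / 2" using h\<delta> by simp
    define m where "m = M * h powr a"
    assume "\<not> ereal (M * h powr (3 / 2 + \<epsilon>)) \<le> Linf_norm 1 2 (\<lambda>r. f r - \<sigma> r)"
    moreover have "M * h powr (3 / 2 + \<epsilon>) \<le> m"
      unfolding m_def using M h a by (intro mult_left_mono powr_mono') auto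
    ultimately have less: "Linf_norm 1 2 (\<lambda>r. f r - \<sigma> r) < ereal m"
      by (meson ereal_less_eq(3) leI le_less_trans order_less_le_trans)
    have "1 \<in> {1..n - 1}" using n by simp
    then have "times_differentiable_on 4 \<sigma> {uniform_knots h 1<..<uniform_knots h (Suc 1)} \<and>
        (\<forall>r\<in>{uniform_knots h 1<..<uniform_knots h (Suc 1)}. L0 \<sigma> r = 0)"
      using \<sigma> unfolding S0_def by blast
    then have "times_differentiable_on 4 \<sigma> {1<..<1 + h}" "\<And>r. r \<in> {1<..<1 + h} \<Longrightarrow> L0 \<sigma> r = 0"
      by (auto simp: uniform_knots_def)
    then obtain A B C D where ABCD: "\<And>r. r \<in> {1<..<1 + h} \<Longrightarrow>
        \<sigma> r = A + B * of_real (ln r) + of_real (r\<^sup>2) * (C + D * of_real (ln r))"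
      using L0_kernel_representation[of \<sigma> 1 "1 + h"] by (metis zero_less_one)
    define G where "G r = f r - (A + B * of_real (ln r) + of_real (r\<^sup>2) * (C + D * of_real (ln r)))" for r
    have "continuous_on {1..1 + h} G"
      unfolding G_def f_def using a by (intro continuous_intros continuous_on_powr') auto
    then have G: "cmod (G r) \<le> m" if "r \<in> {1..1 + h}" for r
      using that h ABCD by (intro Linf_bound_pointwise[OF less, of 1 "1 + h" G]) (auto simp: G_def)
    \<comment> \<open>The five sampling points \<open>exp (j t)\<close>, \<open>j = 0, \<dots>, 4\<close>, run from \<open>1\<close> to \<open>1 + h\<close>.\<close>
    define t where "t = ln (1 + h) / 4"
    have t0: "0 \<le> t" using h by (simp add: t_def)
    have Q2: "(exp (2 * t))\<^sup>2 = 1 + h" using h by (simp add: t_def flip: exp_of_nat_mult)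
    have Q1: "1 \<le> exp (2 * t)" using t0 by simp
    then have "exp (2 * t) \<le> (exp (2 * t))\<^sup>2" by (intro self_le_power) auto
    then have Q: "1 \<le> exp (2 * t)" "exp (2 * t) \<le> 1 + h" "exp (2 * t) \<le> 2"
      using Q1 Q2 h by auto
    have "cmod (G (exp (real j * t))) \<le> m" if "j \<le> 4" for j
    proof (rule G)
      have "real j * t \<le> 4 * t" using that t0 by (intro mult_right_mono) auto
      then have "exp (real j * t) \<le> exp (4 * t)" by simp
      also have "\<dots> = 1 + h" using h by (simp add: t_def)
      finally have "exp (real j * t) \<le> 1 + h" .
      then show "exp (real j * t) \<in> {1..1 + h}" using t0 by simp
    qed
    then have "t powr a * p (exp (2 * t)) \<le> 36 * m"
      unfolding p_def G_def f_def using t0 Q(3) a(1)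
      by (intro log_power_distance_from_L0_kernel[of t a A B C D m]) simp_all
    moreover have "(h / 8) powr a * (p 1 / 2) \<le> t powr a * p (exp (2 * t))"
    proof (intro mult_mono powr_mono2)
      have "h * h \<le> h * (1 / 2)" using h h0 by (intro mult_left_mono) auto
      then have "h / 2 \<le> h - h\<^sup>2" by (simp add: power2_eq_square)
      also have "\<dots> \<le> ln (1 + h)" using h by (intro ln_one_plus_pos_lower_bound) auto
      finally have "h / 2 \<le> ln (1 + h)" .
      then show "h / 8 \<le> t" by (simp add: t_def)
      have "dist (exp (2 * t)) 1 < \<delta>" using Q h\<delta> by (simp add: dist_real_def)
      then have "dist (p (exp (2 * t))) (p 1) < p 1 / 2" by (rule \<delta>(2))
      then show "p 1 / 2 \<le> p (exp (2 * t))" unfolding dist_real_def by linarith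
    qed (use h a p1 in auto)
    moreover have "(h / 8) powr a * (p 1 / 2) = 40 * m"
      using h by (simp add: m_def M_def powr_divide field_simps)
    moreover have "m > 0" using M h by (simp add: m_def)
    ultimately show False by linarith
  qed
  then have main: "\<forall>n\<ge>2. \<forall>h. h = 1 / (real n - 1) \<longrightarrow> h < min \<delta> (1 / 2) \<longrightarrow> (\<forall>\<sigma>\<in>S0 n (uniform_knots h).
       ereal (M * h powr (3 / 2 + \<epsilon>)) \<le> Linf_norm 1 2 (\<lambda>r. f r - \<sigma> r))"
    by blast
  have "f \<in> Lambda0" unfolding f_def using log_power_in_Lambda0[of a] a by simp
  then show ?thesis using M \<delta>(1) main
    by (intro bexI[of _ f] exI[of _ M] conjI exI[of _ "min \<delta> (1 / 2)"]) simp_all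
qed

end
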